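(* Let $n$ be a positive integer and let $MS(n)$ be the number of multi-symmetric Steinhaus matrices of size $n$. Then $MS(n)=2^{\left\lceil \frac{n}{6}\right\rceil}$ if $n$ is even, and $MS(n)=2^{\left\lceil \frac{n-3}{6}\right\rceil}$ if $n$ is odd.
   Context: A Steinhaus matrix of size $n\geq1$ is a matrix $M=(a_{i,j})_{1\leq i,j\leq n}$ with entries in $\mathbb{F}_2=\{0,1\}$ such that $a_{i,i}=0$ for all $i$, $a_{i,j}=a_{i-1,j-1}+a_{i-1,j}$ (addition in $\mathbb{F}_2$) for all $2\leq i<j\leq n$, and $a_{i,j}=a_{j,i}$ for all $i,j$. A square matrix $(a_{i,j})$ of size $n$ is doubly-symmetric if $a_{i,j}=a_{j,i}=a_{n-j+1,n-i+1}$ for all $i,j$; it is multi-symmetric if it is doubly-symmetric and $a_{i,j}=a_{i,n-j+i+1}$ for all $1\leq i<j\leq n$. *)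

theory Defs
  imports Complex_Main "HOL-Library.Z2" "Jordan_Normal_Form.Matrix"
begin

text \<open>Library matrices are indexed from 0. All definitions below use indices from 1 to n, as in
  the literature on Steinhaus matrices. The field with two elements is the type bit.\<close>

definition entry :: "'a mat \<Rightarrow> nat \<Rightarrow> nat \<Rightarrow> 'a"
  where "entry M i j = M $$ (i - 1, j - 1)"

definition steinhaus_matrix :: "nat \<Rightarrow> bit mat \<Rightarrow> bool"
  where "steinhaus_matrix n M \<longleftrightarrow>
    M \<in> carrier_mat n n \<and>
    (\<forall>i\<in>{1..n}. entry M i i = 0) \<and>
    (\<forall>i j. 2 \<le> i \<and> i < j \<and> j \<le> n \<longrightarrow>
       entry M i j = entry M (i - 1) (j - 1) + entry M (i - 1) j) \<and>
    (\<forall>i\<in>{1..n}. \<forall>j\<in>{1..n}. entry M i j = entry M j i)"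

definition doubly_symmetric :: "nat \<Rightarrow> 'a mat \<Rightarrow> bool"
  where "doubly_symmetric n M \<longleftrightarrow>
    M \<in> carrier_mat n n \<and>
    (\<forall>i\<in>{1..n}. \<forall>j\<in>{1..n}.
       entry M i j = entry M j i \<and>
       entry M j i = entry M (n - j + 1) (n - i + 1))"

definition multi_symmetric :: "nat \<Rightarrow> 'a mat \<Rightarrow> bool"
  where "multi_symmetric n M \<longleftrightarrow>
    doubly_symmetric n M \<and>
    (\<forall>i j. 1 \<le> i \<and> i < j \<and> j \<le> n \<longrightarrow>
       entry M i j = entry M i (n - j + i + 1))"

definition MS :: "nat \<Rightarrow> nat"
  where "MS n = card {M. steinhaus_matrix n M \<and> multi_symmetric n M}"

end

theory Submission
  imports Defs
begin

text \<open>A multi-symmetric Steinhaus matrix of size n is a Steinhaus triangle with n - 1 rows that is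
  invariant under all symmetries of the equilateral triangle, and it is determined by its top row.
  Stripping the outermost entries of such a triangle of side e + 3 leaves one of side e. Conversely,
  an inner triangle forces zeros at the three new corners, and the remaining outer entries are partial
  sums of its top row up to one free bit; these are symmetric iff e is even or the middle entry of the
  inner top row vanishes. For odd e that condition cuts out exactly half of the inner triangles. So
  the count doubles from e to e + 3 if e is even and stays the same if e is odd.\<close>

text \<open>By default sums in bit are rewritten to exclusive disjunction and then to propositional
  logic, which does not scale; the following rules calculate in characteristic 2 instead.\<close>

declare add_bit_eq_xor [simp del]

lemma bit_add_self [simp]: "a + a = 0" for a :: bit
  by (cases a) simp_all

lemma bit_add_add_self [simp]: "a + (a + b) = b" for a :: bit
  by (simp add: add.assoc[symmetric])

lemma bit_add_eq_iff: "a + b = c \<longleftrightarrow> a = b + c" for a :: bit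
  by (auto simp: ac_simps)

section \<open>Steinhaus triangles and the symmetries of their top rows\<close>

fun steinhaus_triangle :: "(nat \<Rightarrow> bit) \<Rightarrow> nat \<Rightarrow> nat \<Rightarrow> bit" where
  "steinhaus_triangle s 0 k = s k"
| "steinhaus_triangle s (Suc i) k = steinhaus_triangle s i k + steinhaus_triangle s i (Suc k)"

text \<open>The zero padding from \<open>m\<close> on makes equality of rows of length
  \<open>m\<close> plain equality of functions. The other two conditions express invariance under
  two reflections of the triangle, left-right and top row against left side; together these generate
  all six symmetries.\<close>

definition invariant_rows :: "nat \<Rightarrow> (nat \<Rightarrow> bit) set" where
  "invariant_rows m = {s. (\<forall>k\<ge>m. s k = 0) \<and> (\<forall>k<m. s k = s (m - 1 - k)) \<and>
     (\<forall>i<m. steinhaus_triangle s i 0 = s i)}"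

lemma invariant_rowsI:
  assumes "\<And>k. k \<ge> m \<Longrightarrow> s k = 0" and "\<And>k. k < m \<Longrightarrow> s k = s (m - 1 - k)"
    and "\<And>i. i < m \<Longrightarrow> steinhaus_triangle s i 0 = s i"
  shows "s \<in> invariant_rows m"
  unfolding invariant_rows_def using assms by blast

lemma invariant_rowsD:
  assumes "s \<in> invariant_rows m"
  shows "k \<ge> m \<Longrightarrow> s k = 0" and "k < m \<Longrightarrow> s k = s (m - 1 - k)"
    and "k < m \<Longrightarrow> steinhaus_triangle s k 0 = s k"
  using assms unfolding invariant_rows_def by blast+

lemma UNIV_bit: "(UNIV :: bit set) = {0, 1}"
  by auto

text \<open>The local rule treats both parents alike, so a symmetry of the top row passes down. Row
  \<open>i\<close> has \<open>m - i\<close> entries, hence the mirror index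
  \<open>m - 1 - i - k\<close>.\<close>

lemma steinhaus_triangle_reflect:
  assumes "\<And>k. k < m \<Longrightarrow> s k = s (m - 1 - k)" and "i + k < m"
  shows "steinhaus_triangle s i k = steinhaus_triangle s i (m - 1 - i - k)"
  using assms(2)
proof (induction i arbitrary: k)
  case 0
  then show ?case using assms(1)[of k] by simp
next
  case (Suc i)
  have "m - 1 - i - k = Suc (m - 1 - Suc i - k)" using Suc.prems by simp
  moreover have "m - 1 - i - Suc k = m - 1 - Suc i - k" by simp
  ultimately show ?case
    using Suc.IH[of k] Suc.IH[of "Suc k"] Suc.prems by (simp add: add.commute)
qed

text \<open>In characteristic 2 the local rule says that the entries at \<open>(i, k)\<close>,
  \<open>(i, k + 1)\<close> and \<open>(i + 1, k)\<close> sum to 0, which is unchanged by exchanging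
  the coordinates. So the triangle may equally be generated from its left side.\<close>

lemma steinhaus_triangle_swap:
  assumes "\<And>i. i < m \<Longrightarrow> steinhaus_triangle s i 0 = s i" and "i + k < m"
  shows "steinhaus_triangle s i k = steinhaus_triangle s k i"
  using assms(2)
proof (induction k arbitrary: i)
  case 0
  then show ?case using assms(1)[of i] by simp
next
  case (Suc k)
  have "steinhaus_triangle s i (Suc k) = steinhaus_triangle s i k + steinhaus_triangle s (Suc i) k"
    by (simp add: bit_add_eq_iff)
  then show ?case
    using Suc.IH[of i] Suc.IH[of "Suc i"] Suc.prems by (simp add: bit_add_eq_iff)
qed

lemma steinhaus_triangle_add:
  "steinhaus_triangle (\<lambda>k. s k + t k) i k = steinhaus_triangle s i k + steinhaus_triangle t i k"
proof (induction i arbitrary: k)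
  case (Suc i)
  have "(a + b) + (c + d) = (a + c) + (b + d)" for a b c d :: bit by (simp add: ac_simps)
  then show ?case unfolding steinhaus_triangle.simps Suc.IH by metis
qed simp

lemma steinhaus_triangle_zero: "steinhaus_triangle (\<lambda>k. 0) i k = 0"
  by (induction i arbitrary: k) simp_all

lemma invariant_rows_reflect:
  assumes "s \<in> invariant_rows m" and "i + k < m"
  shows "steinhaus_triangle s i k = steinhaus_triangle s i (m - 1 - i - k)"
  by (rule steinhaus_triangle_reflect[where s = s and m = m,
        OF invariant_rowsD(2)[OF assms(1)] assms(2)])

lemma invariant_rows_swap:
  assumes "s \<in> invariant_rows m" and "i + k < m"
  shows "steinhaus_triangle s i k = steinhaus_triangle s k i"
  by (rule steinhaus_triangle_swap[where s = s and m = m,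
        OF invariant_rowsD(3)[OF assms(1)] assms(2)])

lemma zero_invariant_rows: "(\<lambda>k. 0) \<in> invariant_rows m"
  by (rule invariant_rowsI) (simp_all add: steinhaus_triangle_zero)

lemma add_invariant_rows:
  assumes s: "s \<in> invariant_rows m" and t: "t \<in> invariant_rows m"
  shows "(\<lambda>k. s k + t k) \<in> invariant_rows m"
proof (rule invariant_rowsI)
  show "s k + t k = s (m - 1 - k) + t (m - 1 - k)" if "k < m" for k
    using invariant_rowsD(2)[OF s that] invariant_rowsD(2)[OF t that] by metis
qed (simp_all add: steinhaus_triangle_add invariant_rowsD(1,3)[OF s] invariant_rowsD(1,3)[OF t])

lemma finite_invariant_rows: "finite (invariant_rows m)"
proof (rule finite_subset)
  show "invariant_rows m \<subseteq> {s. \<forall>k. (k \<in> {..<m} \<longrightarrow> s k \<in> UNIV) \<and> (k \<notin> {..<m} \<longrightarrow> s k = 0)}"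
    using invariant_rowsD(1) by auto
  have "finite (UNIV :: bit set)" by (simp add: UNIV_bit)
  then show "finite {s. \<forall>k. (k \<in> {..<m} \<longrightarrow> s k \<in> (UNIV :: bit set)) \<and> (k \<notin> {..<m} \<longrightarrow> s k = 0)}"
    by (intro finite_set_of_finite_funs) auto
qed

section \<open>Removing and restoring the outermost layer of a triangle\<close>

definition inner_row :: "nat \<Rightarrow> (nat \<Rightarrow> bit) \<Rightarrow> nat \<Rightarrow> bit" where
  "inner_row e s k = (if k < e then s (Suc k) + s (Suc (Suc k)) else 0)"

text \<open>This solves \<open>inner_row e s = p\<close> for \<open>s\<close>, with corners
  \<open>s 0 = s (e + 2) = 0\<close> and starting value \<open>s 1 = t\<close>: each further entry
  is the previous one plus an entry of \<open>p\<close>.\<close>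

definition outer_row :: "nat \<Rightarrow> (nat \<Rightarrow> bit) \<Rightarrow> bit \<Rightarrow> nat \<Rightarrow> bit" where
  "outer_row e p t k = (if 1 \<le> k \<and> k \<le> e + 1 then t + (\<Sum>b<k - 1. p b) else 0)"

lemma steinhaus_triangle_inner:
  assumes "\<And>k. k < e \<Longrightarrow> p k = s (Suc k) + s (Suc (Suc k))" and "i + k < e"
  shows "steinhaus_triangle p i k = steinhaus_triangle s (Suc i) (Suc k)"
  using assms(2)
proof (induction i arbitrary: k)
  case 0
  then show ?case using assms(1)[of k] by simp
next
  case (Suc i)
  then show ?case using Suc.IH[of k] Suc.IH[of "Suc k"] by simp
qed

text \<open>The interior is the same triangle with both coordinates shifted by 1, and every symmetry
  of the large triangle maps it to itself.\<close>

lemma inner_row_invariant: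
  assumes s: "s \<in> invariant_rows (e + 3)"
  shows "inner_row e s \<in> invariant_rows e"
proof -
  have tri: "steinhaus_triangle (inner_row e s) i k = steinhaus_triangle s (Suc i) (Suc k)"
    if "i + k < e" for i k
    using that by (intro steinhaus_triangle_inner[of e]) (auto simp: inner_row_def)
  have "inner_row e s k = inner_row e s (e - 1 - k)" if "k < e" for k
  proof -
    have eq: "e + 3 - 1 - 1 - Suc k = Suc (e - 1 - k)" using that by simp
    show ?thesis
      using tri[of 0 k] tri[of 0 "e - 1 - k"] invariant_rows_reflect[OF s, of 1 "Suc k"] that
      unfolding One_nat_def[symmetric] eq by simp
  qed
  moreover have "steinhaus_triangle (inner_row e s) i 0 = inner_row e s i" if "i < e" for i
    using tri[of i 0] tri[of 0 i] invariant_rows_swap[OF s, of "Suc i" 1] that by simp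
  moreover have "inner_row e s k = 0" if "e \<le> k" for k using that by (simp add: inner_row_def)
  ultimately show ?thesis by (intro invariant_rowsI)
qed

text \<open>By symmetry the first \<open>e - k\<close> entries have the same sum as the last
  \<open>e - k\<close>, and these are exactly the entries missing from the first
  \<open>k\<close>.\<close>

lemma sum_lessThan_reflect:
  fixes p :: "nat \<Rightarrow> bit"
  assumes "\<And>k. k < e \<Longrightarrow> p k = p (e - 1 - k)" and "k \<le> e"
  shows "(\<Sum>b<k. p b) + (\<Sum>b<e - k. p b) = (\<Sum>b<e. p b)"
  using assms(2)
proof (induction k)
  case 0
  then show ?case by simp
next
  case (Suc k)
  have "e - k = Suc (e - Suc k)" using Suc.prems by simp
  moreover have "p k = p (e - Suc k)" using assms(1)[of k] Suc.prems by simp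
  ultimately have "(\<Sum>b<e - k. p b) = (\<Sum>b<e - Suc k. p b) + p k"
    by (simp add: lessThan_Suc add.commute)
  then show ?case using Suc by (simp add: lessThan_Suc ac_simps)
qed

lemma outer_row_step:
  assumes "k < e"
  shows "p k = outer_row e p t (Suc k) + outer_row e p t (Suc (Suc k))"
proof -
  have "outer_row e p t (Suc (Suc k)) = outer_row e p t (Suc k) + p k"
    using assms by (simp add: outer_row_def lessThan_Suc ac_simps)
  then show ?thesis by (simp add: bit_add_eq_iff)
qed

text \<open>Left-right symmetry of the partial sums amounts to \<open>p\<close> having total sum 0,
  which is what \<open>mid\<close> secures. Agreement of the left side with the top row is then
  checked by descending along the left side.\<close>

lemma outer_row_invariant:
  assumes p: "p \<in> invariant_rows e" and mid: "even e \<or> p (e div 2) = 0"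
  shows "outer_row e p t \<in> invariant_rows (e + 3)"
proof -
  let ?s = "outer_row e p t"
  have psym: "p k = p (e - 1 - k)" if "k < e" for k
    by (rule invariant_rowsD(2)[OF p that])
  have refl: "(\<Sum>b<k. p b) + (\<Sum>b<e - k. p b) = (\<Sum>b<e. p b)" if "k \<le> e" for k
    by (rule sum_lessThan_reflect) (fact psym, fact that)
  \<comment> \<open>Mirror entries of \<open>p\<close> cancel in pairs. For odd \<open>e\<close>
    only the middle entry is left over, and it vanishes by \<open>mid\<close>.\<close>
  have tot: "(\<Sum>b<e. p b) = 0"
  proof (cases "even e")
    case True
    then obtain h where "e = 2 * h" by auto
    then show ?thesis using refl[of h] by (simp add: mult_2)
  next
    case False
    then obtain h where h: "e = 2 * h + 1" by (auto elim: oddE)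
    have "e - h = Suc h" using h by simp
    then have "(\<Sum>b<e. p b) = (\<Sum>b<h. p b) + ((\<Sum>b<h. p b) + p h)"
      using refl[of h] h by (simp add: lessThan_Suc ac_simps)
    also have "\<dots> = p h" by (simp add: add.assoc[symmetric])
    finally show ?thesis using mid h by simp
  qed
  have sym: "?s k = ?s (e + 3 - 1 - k)" if "k < e + 3" for k
  proof (cases "1 \<le> k \<and> k \<le> e + 1")
    case True
    then have "k - 1 \<le> e" by linarith
    from refl[OF this] have "(\<Sum>b<k - 1. p b) = (\<Sum>b<e - (k - 1). p b)"
      unfolding tot bit_add_eq_iff by simp
    moreover have "e + 3 - 1 - k - 1 = e - (k - 1)" "1 \<le> e + 3 - 1 - k" "e + 3 - 1 - k \<le> e + 1"
      using True by auto
    ultimately show ?thesis using True by (simp add: outer_row_def)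
  next
    case False
    then have "k = 0 \<or> k = e + 2" using that by auto
    then show ?thesis by (auto simp: outer_row_def)
  qed
  have "steinhaus_triangle ?s i 0 = ?s i" if "i < e + 3" for i
    using that
  proof (induction i)
    case 0
    then show ?case by simp
  next
    case (Suc i)
    have IH: "steinhaus_triangle ?s i 0 = ?s i" using Suc by simp
    \<comment> \<open>Just below the top corner, \<open>s 0 = 0\<close> gives the claim. At the
      bottom corner, the two entries of row \<open>e + 1\<close> are mirror images, so they cancel.
      In between, the neighbour to the right lies on the left side of the inner triangle and so
      equals \<open>p j\<close>.\<close>
    consider "i = 0" | "i = Suc e" | j where "i = Suc j" "j < e"
    proof (cases i)
      case (Suc j)
      then show thesis using that Suc.prems by (cases "j = e") auto
    qed (use that in simp)
    then show ?case
    proof cases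
      case 1
      then show ?thesis by (simp add: outer_row_def)
    next
      case 2
      then have "steinhaus_triangle ?s i 0 = steinhaus_triangle ?s i 1"
        using steinhaus_triangle_reflect[of "e + 3" ?s i 0, OF sym] by simp
      then have "steinhaus_triangle ?s (Suc i) 0 = 0" by simp
      moreover have "?s (Suc i) = 0" using 2 by (simp add: outer_row_def)
      ultimately show ?thesis by metis
    next
      case (3 j)
      have "steinhaus_triangle ?s (Suc j) (Suc 0) = steinhaus_triangle p j 0"
        using 3 by (intro steinhaus_triangle_inner[symmetric, of e] outer_row_step) auto
      also have "\<dots> = p j" using invariant_rowsD(3)[OF p] 3 by simp
      finally show ?thesis
        using IH 3 outer_row_step[OF \<open>j < e\<close>, of p t] by (simp add: bit_add_eq_iff)
    qed
  qed
  moreover have "?s k = 0" if "e + 3 \<le> k" for k using that by (simp add: outer_row_def)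
  ultimately show ?thesis using sym by (intro invariant_rowsI)
qed

lemma inner_outer_row:
  assumes p: "p \<in> invariant_rows e"
  shows "inner_row e (outer_row e p t) = p"
proof
  show "inner_row e (outer_row e p t) k = p k" for k
    using invariant_rowsD(1)[OF p, of k] outer_row_step[of k e p t] by (simp add: inner_row_def)
qed

text \<open>The sums of adjacent entries telescope, so an invariant row is recovered from its inner
  row and \<open>s 1\<close> once its corners are known to vanish.\<close>

lemma outer_inner_row:
  assumes s: "s \<in> invariant_rows (e + 3)"
  shows "outer_row e (inner_row e s) (s 1) = s"
proof
  fix k
  \<comment> \<open>Row 1 begins with \<open>s 0 + s 1\<close>, which invariance equates with
    \<open>s 1\<close>. This forces the corner \<open>s 0\<close> to be 0, and reflection carries
    the zero to the other end.\<close>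
  have "steinhaus_triangle s 1 0 = s 1" using invariant_rowsD(3)[OF s, of 1] by simp
  then have s0: "s 0 = 0" by simp
  from invariant_rowsD(2)[OF s, of 0] have last: "s (e + 2) = 0" using s0 by simp
  have sum: "s 1 + (\<Sum>b<k. inner_row e s b) = s (Suc k)" if "k \<le> e" for k
    using that
  proof (induction k)
    case (Suc k)
    then have "s 1 + (\<Sum>b<Suc k. inner_row e s b) = s (Suc k) + inner_row e s k"
      by (simp add: lessThan_Suc ac_simps)
    then show ?case using Suc by (simp add: inner_row_def add.assoc[symmetric])
  qed simp
  consider "k = 0" | "1 \<le> k" "k \<le> e + 1" | "k = e + 2" | "k \<ge> e + 3" by linarith
  then show "outer_row e (inner_row e s) (s 1) k = s k"
  proof cases
    case 2
    then show ?thesis using sum[of "k - 1"] by (simp add: outer_row_def)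
  qed (use invariant_rowsD(1)[OF s] s0 last in \<open>auto simp: outer_row_def\<close>)
qed

text \<open>For odd \<open>e\<close> the outer row has even length; its two central entries are
  mirror images, and the middle of the inner row is their sum.\<close>

lemma inner_row_mid:
  assumes s: "s \<in> invariant_rows (e + 3)" and "odd e"
  shows "inner_row e s (e div 2) = 0"
proof -
  obtain h where h: "e = 2 * h + 1" using \<open>odd e\<close> by (auto elim: oddE)
  from invariant_rowsD(2)[OF s, of "Suc h"] have "s (Suc h) = s (Suc (Suc h))"
    using h by (simp add: eval_nat_numeral)
  then show ?thesis using h by (simp add: inner_row_def)
qed

section \<open>Counting invariant rows\<close>

lemma card_invariant_rows_add_3:
  "card (invariant_rows (e + 3)) = 2 * card {p \<in> invariant_rows e. even e \<or> p (e div 2) = 0}"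
proof -
  let ?A = "{p \<in> invariant_rows e. even e \<or> p (e div 2) = 0}"
  \<comment> \<open>The second component is the free bit of the outer layer, which accounts for the
    factor 2.\<close>
  have "bij_betw (\<lambda>s. (inner_row e s, s 1)) (invariant_rows (e + 3)) (?A \<times> (UNIV :: bit set))"
  proof (rule bij_betw_byWitness[where f' = "\<lambda>(p, t). outer_row e p t"])
    show "\<forall>s\<in>invariant_rows (e + 3). (\<lambda>(p, t). outer_row e p t) (inner_row e s, s 1) = s"
      using outer_inner_row by simp
    show "\<forall>q\<in>?A \<times> UNIV. (\<lambda>s. (inner_row e s, s 1)) ((\<lambda>(p, t). outer_row e p t) q) = q"
      using inner_outer_row by (auto simp: outer_row_def)
    show "(\<lambda>s. (inner_row e s, s 1)) ` invariant_rows (e + 3) \<subseteq> ?A \<times> UNIV"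
      using inner_row_invariant inner_row_mid by auto
    show "(\<lambda>(p, t). outer_row e p t) ` (?A \<times> UNIV) \<subseteq> invariant_rows (e + 3)"
      using outer_row_invariant by auto
  qed
  then have "card (invariant_rows (e + 3)) = card (?A \<times> (UNIV :: bit set))"
    by (rule bij_betw_same_card)
  then show ?thesis by (simp add: card_cartesian_product UNIV_bit)
qed

lemma invariant_rows_1: "invariant_rows (Suc 0) = {\<lambda>k. 0, \<lambda>k. if k = 0 then 1 else 0}"
proof -
  have "s = (\<lambda>k. 0) \<or> s = (\<lambda>k. if k = 0 then 1 else 0)" if "s \<in> invariant_rows 1" for s
  proof (cases "s 0")
    case zero
    then have "s k = 0" for k using that by (cases k) (auto dest: invariant_rowsD(1))
    then show ?thesis by auto
  next
    case one
    then have "s k = (if k = 0 then 1 else 0)" for k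
      using that by (cases k) (auto dest: invariant_rowsD(1))
    then show ?thesis by auto
  qed
  moreover have "(\<lambda>k. if k = 0 then 1 else 0) \<in> invariant_rows (Suc 0)"
    by (rule invariant_rowsI) auto
  ultimately show ?thesis using zero_invariant_rows by auto
qed

lemma exists_invariant_row_mid_eq_1:
  assumes "odd e"
  shows "\<exists>u\<in>invariant_rows e. u (e div 2) = 1"
proof (cases "e = 1")
  case True
  then show ?thesis by (auto simp: invariant_rows_1)
next
  case False
  then have "e - 3 + 3 = e" using assms by presburger
  then obtain d where e: "e = d + 3" by (rule that[OF sym])
  \<comment> \<open>Around the zero triangle with free bit 1, the outer row is 0, 1, ..., 1, 0, so
    its middle entry is 1.\<close>
  have "outer_row d (\<lambda>k. 0) 1 \<in> invariant_rows e"
    unfolding e by (rule outer_row_invariant) (simp_all add: zero_invariant_rows)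
  moreover have "outer_row d (\<lambda>k. 0) 1 (e div 2) = 1"
  proof -
    have "1 \<le> e div 2 \<and> e div 2 \<le> d + 1" unfolding e by presburger
    then show ?thesis by (simp add: outer_row_def)
  qed
  ultimately show ?thesis by blast
qed

text \<open>Invariant rows are closed under addition, so adding a fixed one with middle entry 1
  exchanges the two possible values of the middle entry bijectively.\<close>

lemma card_invariant_rows_odd_mid:
  assumes "odd e"
  shows "2 * card {p \<in> invariant_rows e. p (e div 2) = 0} = card (invariant_rows e)"
proof -
  let ?A = "\<lambda>t. {p \<in> invariant_rows e. p (e div 2) = t}"
  obtain u where u: "u \<in> invariant_rows e" "u (e div 2) = 1"
    using exists_invariant_row_mid_eq_1[OF assms] by blast
  have "bij_betw (\<lambda>p k. p k + u k) (?A 0) (?A 1)"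
  proof (rule bij_betw_byWitness[where f' = "\<lambda>p k. p k + u k"])
    show "\<forall>p\<in>?A 0. (\<lambda>k. p k + u k + u k) = p" "\<forall>p\<in>?A 1. (\<lambda>k. p k + u k + u k) = p"
      by (simp_all add: add.assoc)
    show "(\<lambda>p k. p k + u k) ` ?A 0 \<subseteq> ?A 1" "(\<lambda>p k. p k + u k) ` ?A 1 \<subseteq> ?A 0"
      using u by (auto intro: add_invariant_rows)
  qed
  then have "card (?A 0) = card (?A 1)" by (rule bij_betw_same_card)
  moreover have "invariant_rows e = ?A 0 \<union> ?A 1" by auto
  moreover have "card (?A 0 \<union> ?A 1) = card (?A 0) + card (?A 1)"
    by (rule card_Un_disjoint) (auto simp: finite_invariant_rows)
  ultimately show ?thesis by simp
qed

lemma card_invariant_rows: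
  "card (invariant_rows m) = 2 ^ (if odd m then m div 6 + 1 else (m + 2) div 6)"
proof (induction m rule: less_induct)
  case (less m)
  consider "m = 0" | "m = 1" | "m = 2" | e where "m = e + 3"
  proof -
    have "m = 0 \<or> m = 1 \<or> m = 2 \<or> m = (m - 3) + 3" by linarith
    then show thesis using that by blast
  qed
  then show ?case
  proof cases
    case 1
    have "invariant_rows 0 = {\<lambda>k. 0}" by (auto simp: invariant_rows_def)
    then show ?thesis using 1 by simp
  next
    case 2
    have "(\<lambda>k. 0 :: bit) \<noteq> (\<lambda>k. if k = (0 :: nat) then 1 else 0)"
      by (auto simp: fun_eq_iff)
    then show ?thesis using 2 by (simp add: invariant_rows_1)
  next
    case 3
    have "s = (\<lambda>k. 0)" if s: "s \<in> invariant_rows 2" for s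
    proof
      fix k
      have "s 0 = 0" "s (Suc 0) = 0" "k \<ge> 2 \<Longrightarrow> s k = 0"
        using invariant_rowsD(3)[OF s, of 1] invariant_rowsD(2)[OF s, of 0]
          invariant_rowsD(1)[OF s, of k] by simp_all
      moreover have "k = 0 \<or> k = Suc 0 \<or> k \<ge> 2" by linarith
      ultimately show "s k = 0" by blast
    qed
    then have "invariant_rows 2 = {\<lambda>k. 0}" using zero_invariant_rows by blast
    then show ?thesis using 3 by simp
  next
    case (4 e)
    have IH: "card (invariant_rows e) = 2 ^ (if odd e then e div 6 + 1 else (e + 2) div 6)"
      using less.IH[of e] 4 by simp
    show ?thesis
    proof (cases "even e")
      case True
      \<comment> \<open>Here \<open>e + 3\<close> is odd and the count doubles, so the quotients
        must agree. Division by 6 is split into division by 2, after which they coincide, and then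
        by 3.\<close>
      then have "(e + 3) div 6 = (e + 2) div 6"
        using div_mult2_eq[of "e + 3" 2 3] div_mult2_eq[of "e + 2" 2 3] by (auto elim!: evenE)
      then show ?thesis using True IH 4 card_invariant_rows_add_3[of e] by simp
    next
      case False
      \<comment> \<open>The halving by the middle condition cancels the doubling, so the exponents
        for \<open>e\<close> and \<open>e + 3\<close> must be equal.\<close>
      then have "(e + 3 + 2) div 2 = e div 2 + 3" by presburger
      then have "(e + 3 + 2) div 6 = e div 6 + 1"
        using div_mult2_eq[of "e + 3 + 2" 2 3] div_mult2_eq[of e 2 3] div_add_self2[of 3 "e div 2"]
        by simp
      then show ?thesis
        using False IH 4 card_invariant_rows_add_3[of e] card_invariant_rows_odd_mid[of e]
        by simp
    qed
  qed
qed

section \<open>Correspondence between matrices and invariant rows\<close>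

definition row_matrix :: "nat \<Rightarrow> (nat \<Rightarrow> bit) \<Rightarrow> bit mat" where
  "row_matrix n s = mat n n (\<lambda>(i, j). if i = j then 0
     else steinhaus_triangle s (min i j) (max i j - min i j - 1))"

definition first_row :: "nat \<Rightarrow> bit mat \<Rightarrow> nat \<Rightarrow> bit" where
  "first_row n M k = (if k < n - 1 then M $$ (0, k + 1) else 0)"

lemma steinhaus_matrixD:
  assumes "steinhaus_matrix n M"
  shows "M \<in> carrier_mat n n" and "i \<in> {1..n} \<Longrightarrow> entry M i i = 0"
    and "2 \<le> i \<Longrightarrow> i < j \<Longrightarrow> j \<le> n \<Longrightarrow>
      entry M i j = entry M (i - 1) (j - 1) + entry M (i - 1) j"
    and "i \<in> {1..n} \<Longrightarrow> j \<in> {1..n} \<Longrightarrow> entry M i j = entry M j i"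
  using assms unfolding steinhaus_matrix_def by blast+

text \<open>With indices from 1, entry \<open>k\<close> of triangle row \<open>a\<close> sits at
  position \<open>(a + 1, a + k + 2)\<close>: \<open>k\<close> counts from the first superdiagonal,
  as the zero diagonal is not part of the triangle.\<close>

lemma entry_row_matrix:
  assumes "1 \<le> i" "i < j" "j \<le> n"
  shows "entry (row_matrix n s) i j = steinhaus_triangle s (i - 1) (j - i - 1)"
    and "entry (row_matrix n s) j i = steinhaus_triangle s (i - 1) (j - i - 1)"
proof -
  have "j - 1 - (i - 1) - 1 = j - i - 1" "i - 1 < j - 1" "j - 1 < n" using assms by auto
  then show "entry (row_matrix n s) i j = steinhaus_triangle s (i - 1) (j - i - 1)"
    and "entry (row_matrix n s) j i = steinhaus_triangle s (i - 1) (j - i - 1)"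
    by (simp_all add: entry_def row_matrix_def min_def max_def)
qed

lemma row_matrix_carrier: "row_matrix n s \<in> carrier_mat n n"
  by (simp add: row_matrix_def)

lemma entry_row_matrix_diag: "i \<in> {1..n} \<Longrightarrow> entry (row_matrix n s) i i = 0"
  by (auto simp: entry_def row_matrix_def)

lemma entry_row_matrix_commute:
  assumes "i \<in> {1..n}" "j \<in> {1..n}"
  shows "entry (row_matrix n s) i j = entry (row_matrix n s) j i"
  using assms entry_row_matrix[of i j n s] entry_row_matrix[of j i n s]
  by (cases i j rule: linorder_cases) auto

lemma steinhaus_row_matrix: "steinhaus_matrix n (row_matrix n s)"
proof -
  have "entry (row_matrix n s) i j =
      entry (row_matrix n s) (i - 1) (j - 1) + entry (row_matrix n s) (i - 1) j"
    if "2 \<le> i \<and> i < j \<and> j \<le> n" for i j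
  proof -
    have "i = Suc (Suc (i - 2))" using that by linarith
    then obtain h where h: "i = Suc (Suc h)" by blast
    have "j - Suc h - 1 = Suc (j - i - 1)" "j - 1 - Suc h - 1 = j - i - 1" "Suc h < j - 1" "j - 1 \<le> n"
      using that h by auto
    then show ?thesis
      using that h entry_row_matrix(1)[of i j n s] entry_row_matrix(1)[of "Suc h" "j - 1" n s]
        entry_row_matrix(1)[of "Suc h" j n s] by simp
  qed
  then show ?thesis
    unfolding steinhaus_matrix_def
    by (intro conjI ballI allI impI row_matrix_carrier entry_row_matrix_diag entry_row_matrix_commute)
qed

lemma multi_symmetric_row_matrix:
  assumes s: "s \<in> invariant_rows (n - 1)"
  shows "multi_symmetric n (row_matrix n s)"
proof -
  let ?M = "row_matrix n s"
  have double: "entry ?M i j = entry ?M (n - j + 1) (n - i + 1)"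
    if "1 \<le> i" "i < j" "j \<le> n" for i j
  proof -
    define a b where "a = i - 1" and "b = j - i - 1"
    have ab: "a + b < n - 1" and idx: "n - j = n - 1 - 1 - b - a"
        "n - i + 1 - (n - j + 1) - 1 = b"
      using that by (auto simp: a_def b_def)
    \<comment> \<open>Reflection in the antidiagonal is the third reflection of the triangle. It is
      obtained from the other two as swap, left-right reflection, swap.\<close>
    have "steinhaus_triangle s a b = steinhaus_triangle s (n - j) b"
      using invariant_rows_swap[OF s, of a b] invariant_rows_reflect[OF s, of b a]
        invariant_rows_swap[OF s, of b "n - j"] ab idx by auto
    then show ?thesis
      using that idx entry_row_matrix(1)[of i j n s]
        entry_row_matrix(1)[of "n - j + 1" "n - i + 1" n s]
      by (auto simp: a_def b_def)
  qed
  have "entry ?M j i = entry ?M (n - j + 1) (n - i + 1)"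
    if ij: "i \<in> {1..n}" "j \<in> {1..n}" for i j
  proof (cases i j rule: linorder_cases)
    case less
    then show ?thesis using double[of i j] entry_row_matrix_commute[OF ij] ij by simp
  next
    case equal
    moreover have "n - j + 1 \<in> {1..n}" using ij by auto
    ultimately show ?thesis using ij entry_row_matrix_diag by metis
  next
    case greater
    then have "entry ?M j i = entry ?M (n - i + 1) (n - j + 1)" using double[of j i] ij by simp
    also have "\<dots> = entry ?M (n - j + 1) (n - i + 1)"
      using ij by (intro entry_row_matrix_commute) auto
    finally show ?thesis .
  qed
  moreover have "entry ?M i j = entry ?M i (n - j + i + 1)"
    if "1 \<le> i \<and> i < j \<and> j \<le> n" for i j
  proof -
    have "n - j + i + 1 - i - 1 = n - 1 - 1 - (i - 1) - (j - i - 1)" using that by auto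
    then show ?thesis
      using that invariant_rows_reflect[OF s, of "i - 1" "j - i - 1"]
        entry_row_matrix(1)[of i j n s] entry_row_matrix(1)[of i "n - j + i + 1" n s]
      by auto
  qed
  ultimately show ?thesis
    unfolding multi_symmetric_def doubly_symmetric_def
    by (intro conjI ballI allI impI row_matrix_carrier entry_row_matrix_commute)
qed

lemma first_row_row_matrix:
  assumes s: "s \<in> invariant_rows (n - 1)"
  shows "first_row n (row_matrix n s) = s"
proof
  show "first_row n (row_matrix n s) k = s k" for k
    using invariant_rowsD(1)[OF s, of k] by (auto simp: first_row_def row_matrix_def)
qed

lemma steinhaus_matrix_entry:
  assumes M: "steinhaus_matrix n M" and "Suc i < j" "j \<le> n"
  shows "entry M (Suc i) j = steinhaus_triangle (first_row n M) i (j - Suc i - 1)"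
  using assms(2,3)
proof (induction i arbitrary: j)
  case 0
  then have "j = Suc (Suc (j - 2))" by linarith
  then obtain k where "j = Suc (Suc k)" by blast
  then show ?case using 0 by (simp add: first_row_def entry_def)
next
  case (Suc i)
  have "j = Suc (Suc (Suc (i + (j - i - 3))))" using Suc.prems by linarith
  then obtain k where j: "j = Suc (Suc (Suc (i + k)))" by blast
  have "entry M (Suc (Suc i)) j = entry M (Suc i) (j - 1) + entry M (Suc i) j"
    using steinhaus_matrixD(3)[OF M, of "Suc (Suc i)" j] Suc.prems by simp
  then show ?case using Suc.IH[of "j - 1"] Suc.IH[of j] Suc.prems by (simp add: j)
qed

lemma row_matrix_first_row:
  assumes M: "steinhaus_matrix n M"
  shows "row_matrix n (first_row n M) = M"
proof (rule eq_matI)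
  note car = steinhaus_matrixD(1)[OF M] and sym = steinhaus_matrixD(4)[OF M]
  show "dim_row (row_matrix n (first_row n M)) = dim_row M"
    "dim_col (row_matrix n (first_row n M)) = dim_col M"
    using car by (simp_all add: row_matrix_def)
  have upper: "entry (row_matrix n (first_row n M)) i j = entry M i j"
    if "1 \<le> i" "i < j" "j \<le> n" for i j
    using that steinhaus_matrix_entry[OF M, of "i - 1" j] by (simp add: entry_row_matrix)
  fix i j
  assume "i < dim_row M" "j < dim_col M"
  then have ij: "Suc i \<in> {1..n}" "Suc j \<in> {1..n}" using car by auto
  have "entry (row_matrix n (first_row n M)) (Suc i) (Suc j) = entry M (Suc i) (Suc j)"
  proof (cases i j rule: linorder_cases)
    case less
    then show ?thesis using upper ij by simp
  next
    case equal
    then show ?thesis using steinhaus_matrixD(2)[OF M ij(1)] entry_row_matrix_diag[OF ij(1)] by simp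
  next
    case greater
    then show ?thesis
      using upper[of "Suc j" "Suc i"] sym[OF ij] entry_row_matrix_commute[OF ij] ij by simp
  qed
  then show "row_matrix n (first_row n M) $$ (i, j) = M $$ (i, j)" by (simp add: entry_def)
qed

lemma first_row_invariant:
  assumes M: "steinhaus_matrix n M" and sym: "multi_symmetric n M"
  shows "first_row n M \<in> invariant_rows (n - 1)"
proof -
  have row: "first_row n M k = entry M 1 (k + 2)" if "k < n - 1" for k
    using that by (simp add: first_row_def entry_def)
  have multi: "entry M i j = entry M i (n - j + i + 1)" if "1 \<le> i" "i < j" "j \<le> n" for i j
    using sym that unfolding multi_symmetric_def by blast
  have double: "entry M i j = entry M (n - j + 1) (n - i + 1)"
    if "i \<in> {1..n}" "j \<in> {1..n}" for i j
    using sym that unfolding multi_symmetric_def doubly_symmetric_def by metis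
  have refl: "first_row n M k = first_row n M (n - 1 - 1 - k)" if "k < n - 1" for k
  proof -
    have "n - (k + 2) + 1 + 1 = n - 1 - 1 - k + 2" "n - 1 - 1 - k < n - 1" using that by auto
    then show ?thesis using multi[of 1 "k + 2"] row[of k] row[of "n - 1 - 1 - k"] that by simp
  qed
  have "steinhaus_triangle (first_row n M) i 0 = first_row n M i" if "i < n - 1" for i
  proof -
    \<comment> \<open>The left side is carried to the top row by three reflections: within row
      \<open>i + 1\<close> to the last column, then in the antidiagonal to row 1, then within row
      1.\<close>
    have "steinhaus_triangle (first_row n M) i 0 = entry M (i + 1) (i + 2)"
      using steinhaus_matrix_entry[OF M, of i "i + 2"] that by simp
    also have "\<dots> = entry M (i + 1) n"
    proof -
      have "n - (i + 2) + (i + 1) + 1 = n" using that by simp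
      then show ?thesis using multi[of "i + 1" "i + 2"] that by simp
    qed
    also have "\<dots> = entry M 1 (n - i)"
    proof -
      have "n - (i + 1) + 1 = n - i" using that by simp
      then show ?thesis using double[of "i + 1" n] that by simp
    qed
    also have "\<dots> = entry M 1 (i + 2)"
      using multi[of 1 "n - i"] that by simp
    also have "\<dots> = first_row n M i" using row that by simp
    finally show ?thesis .
  qed
  moreover have "first_row n M k = 0" if "n - 1 \<le> k" for k using that by (simp add: first_row_def)
  ultimately show ?thesis using refl by (intro invariant_rowsI)
qed

lemma MS_eq_card_invariant_rows: "MS n = card (invariant_rows (n - 1))"
proof -
  have "bij_betw (row_matrix n) (invariant_rows (n - 1))
      {M. steinhaus_matrix n M \<and> multi_symmetric n M}"
    by (rule bij_betw_byWitness[where f' = "first_row n"])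
      (auto simp: first_row_row_matrix row_matrix_first_row steinhaus_row_matrix
        multi_symmetric_row_matrix first_row_invariant[simplified])
  then show ?thesis unfolding MS_def by (metis bij_betw_same_card)
qed

section \<open>Rewriting the exponents as ceilings\<close>

theorem theorem5:
  fixes n :: nat
  assumes "n \<ge> 1"
  shows "(even n \<longrightarrow> MS n = 2 ^ nat \<lceil>real n / 6\<rceil>) \<and>
    (odd n \<longrightarrow> MS n = 2 ^ nat \<lceil>(real n - 3) / 6\<rceil>)"
proof (intro conjI impI)
  assume "even n"
  \<comment> \<open>The exponent for the odd row length \<open>n - 1\<close>. With
    \<open>n = 2 * h\<close> it is \<open>(h - 1) div 3 + 1\<close>, the ceiling of
    \<open>h / 3\<close>.\<close>
  define q where "q = (n - 1) div 6 + 1"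
  obtain h where h: "n = 2 * h" using \<open>even n\<close> by blast
  have "(n - 1) div 2 = h - 1" using h by simp
  then have "q = (h - 1) div 3 + 1" using div_mult2_eq[of "n - 1" 2 3] by (simp add: q_def)
  moreover have "3 * ((h - 1) div 3) \<le> h - 1" "h - 1 < 3 * ((h - 1) div 3) + 3" by simp_all
  ultimately have "real (6 * q) < real (n + 6)" "real n \<le> real (6 * q)"
    unfolding of_nat_less_iff of_nat_le_iff using h assms by linarith+
  then have "\<lceil>real n / 6\<rceil> = int q" by (intro ceiling_unique) simp_all
  then have "nat \<lceil>real n / 6\<rceil> = q" by simp
  then show "MS n = 2 ^ nat \<lceil>real n / 6\<rceil>"
    using \<open>even n\<close> assms by (simp add: MS_eq_card_invariant_rows card_invariant_rows q_def)
next
  assume "odd n"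
  \<comment> \<open>The exponent for the even row length \<open>n - 1\<close>. With
    \<open>n = 2 * h + 1\<close> it is \<open>(h + 1) div 3\<close>, the ceiling of
    \<open>(h - 1) / 3\<close>.\<close>
  define q where "q = (n + 1) div 6"
  obtain h where h: "n = 2 * h + 1" using \<open>odd n\<close> by (rule oddE)
  have "(n + 1) div 2 = h + 1" using h by simp
  then have "q = (h + 1) div 3" using div_mult2_eq[of "n + 1" 2 3] by (simp add: q_def)
  moreover have "3 * ((h + 1) div 3) \<le> h + 1" "h + 1 < 3 * ((h + 1) div 3) + 3"
    by simp_all
  ultimately have "real (6 * q) < real (n + 3)" "real n \<le> real (6 * q + 3)"
    unfolding of_nat_less_iff of_nat_le_iff using h by linarith+
  then have "\<lceil>(real n - 3) / 6\<rceil> = int q" by (intro ceiling_unique) simp_all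
  then have "nat \<lceil>(real n - 3) / 6\<rceil> = q" by simp
  moreover have "n - 1 + 2 = n + 1" using assms by simp
  ultimately show "MS n = 2 ^ nat \<lceil>(real n - 3) / 6\<rceil>"
    using \<open>odd n\<close> assms
    by (simp add: MS_eq_card_invariant_rows card_invariant_rows q_def)
qed

end
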